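(* The subspace of $\textsf{ParSym}$ spanned by $\{\textsf{H}_\pi : \pi \text{ a perfect matching}\}$ is a Hopf subalgebra of $\textsf{ParSym}$: it contains $\textsf{H}_\varnothing$, is closed under the product, $\Delta$ maps it into its tensor square, and the antipode $S$ maps it into itself.
   Context: Partition diagrams of order $k$ are set partitions of $\{1,\ldots,k,1',\ldots,k'\}$; $A_0=\{\varnothing\}$. A perfect matching is a partition diagram all of whose blocks have size exactly two (the empty diagram counts as one). For $\pi$ of order $k$, $\rho$ of order $l$: $\pi\otimes\rho$ has as blocks those of $\pi$ and those of $\rho$ shifted ($i\mapsto i+k$, $i'\mapsto(i+k)'$). A diagram is $\otimes$-irreducible if it is not $\rho^{(1)}\otimes\rho^{(2)}$ with both factors nonempty. For nonempty $\pi,\rho$ (orders $k,l$), $\pi\bullet\rho$ is obtained from $\pi\otimes\rho$ by merging the block containing $k'$ with the block containing $(k+1)'$; $\varnothing\bullet\rho=\rho$, $\pi\bullet\varnothing=\pi$. Over a field $\mathbbm{k}$, $\textsf{ParSym}$ has basis $\{\textsf{H}_\pi\}$ over all partition diagrams, product $\textsf{H}_\pi\textsf{H}_\rho=\textsf{H}_{\pi\otimes\rho}$, unit $\textsf{H}_\varnothing$ (free on $\textsf{H}_\pi$, $\pi$ nonempty $\otimes$-irreducible). $\Delta$ is the algebra morphism with $\Delta\textsf{H}_\varnothing=\textsf{H}_\varnothing\otimes\textsf{H}_\varnothing$ and $\Delta\textsf{H}_\pi=\sum\textsf{H}_{G_1}\otimes\textsf{H}_{G_2}$ for nonempty $\otimes$-irreducible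 $\pi$, over ordered pairs $(G_1,G_2)$, each $\varnothing$ or $\otimes$-irreducible, with $G_1\bullet G_2=\pi$. $S$ is the linear antimorphism with $S(\textsf{H}_\varnothing)=\textsf{H}_\varnothing$ and $S(\textsf{H}_\pi)=\sum(-1)^\ell\textsf{H}_{\rho^{(1)}}\cdots\textsf{H}_{\rho^{(\ell)}}$ for nonempty $\otimes$-irreducible $\pi$, over tuples of nonempty diagrams with $\rho^{(1)}\bullet\cdots\bullet\rho^{(\ell)}=\pi$. *)

theory Defs
  imports
    Complex_Main
    "HOL-Library.Disjoint_Sets"
    "HOL-Library.Poly_Mapping"
    "HOL-Library.Product_Plus"
begin

section \<open>Partition diagrams\<close>

text \<open>\<open>Top i\<close> is the vertex $i$ and \<open>Bot i\<close> the vertex $i'$.\<close>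

datatype node = Top nat | Bot nat

definition nodes :: "nat \<Rightarrow> node set" where
  "nodes k = Top ` {1..k} \<union> Bot ` {1..k}"

fun shift :: "nat \<Rightarrow> node \<Rightarrow> node" where
  "shift k (Top i) = Top (i + k)"
| "shift k (Bot i) = Bot (i + k)"

lemma nodes_iff [simp]:
  "Top i \<in> nodes k \<longleftrightarrow> 1 \<le> i \<and> i \<le> k"
  "Bot i \<in> nodes k \<longleftrightarrow> 1 \<le> i \<and> i \<le> k"
  by (auto simp: nodes_def)

lemma nodes_0 [simp]: "nodes 0 = {}"
  by (simp add: nodes_def)

lemma finite_nodes [simp]: "finite (nodes k)"
  by (simp add: nodes_def)

lemma shift_shift: "shift a (shift b x) = shift (a + b) x"
  by (cases x) simp_all

lemma shift_0 [simp]: "shift 0 = (\<lambda>x. x)"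
proof
  show "shift 0 x = x" for x by (cases x) simp_all
qed

lemma inj_shift: "inj (shift k)"
proof (rule injI)
  show "x = y" if "shift k x = shift k y" for x y
    using that by (cases x; cases y) auto
qed

lemma shift_in_nodes: "x \<in> nodes l \<Longrightarrow> shift k x \<in> nodes (k + l)"
  by (cases x) auto

lemma shift_notin_nodes: "x \<in> nodes l \<Longrightarrow> shift k x \<notin> nodes k"
  by (cases x) auto

lemma shift_notin_nodes': "x \<in> nodes l \<Longrightarrow> j \<le> k \<Longrightarrow> shift k x \<notin> nodes j"
  by (cases x) auto

lemma shift_in_nodes_diff: "x \<in> nodes l \<Longrightarrow> shift k x \<in> nodes k' \<Longrightarrow> x \<in> nodes (k' - k)"
  by (cases x) auto

lemma nodes_add: "nodes (k + l) = nodes k \<union> shift k ` nodes l"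
proof (intro equalityI subsetI)
  fix x assume x: "x \<in> nodes (k + l)"
  show "x \<in> nodes k \<union> shift k ` nodes l"
  proof (cases x)
    case (Top i)
    then have "x \<in> nodes k \<or> x = shift k (Top (i - k)) \<and> Top (i - k) \<in> nodes l"
      using x by auto
    then show ?thesis by blast
  next
    case (Bot i)
    then have "x \<in> nodes k \<or> x = shift k (Bot (i - k)) \<and> Bot (i - k) \<in> nodes l"
      using x by auto
    then show ?thesis by blast
  qed
next
  fix x assume "x \<in> nodes k \<union> shift k ` nodes l"
  moreover have "x \<in> nodes (k + l)" if "x \<in> nodes k"
    using that by (cases x) auto
  ultimately show "x \<in> nodes (k + l)"
    using shift_in_nodes by blast
qed

typedef pdiag = "{(k, P). partition_on (nodes k) P}"
  by (rule exI[of _ "(0, {})"]) (simp add: partition_on_empty)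

setup_lifting type_definition_pdiag

lift_definition order :: "pdiag \<Rightarrow> nat" is fst .

lift_definition blocks :: "pdiag \<Rightarrow> node set set" is snd .

lemma partition_on_blocks: "partition_on (nodes (order \<pi>)) (blocks \<pi>)"
  by transfer auto

lemma pdiag_eqI: "order \<pi> = order \<rho> \<Longrightarrow> blocks \<pi> = blocks \<rho> \<Longrightarrow> \<pi> = \<rho>"
  by transfer auto

definition perfect_matching :: "pdiag \<Rightarrow> bool" where
  "perfect_matching \<pi> \<longleftrightarrow> (\<forall>B \<in> blocks \<pi>. card B = 2)"

subsection \<open>Tensor product of diagrams\<close>

lemma partition_on_tensor:
  assumes "partition_on (nodes k) P" "partition_on (nodes l) Q"
  shows "partition_on (nodes (k + l)) (P \<union> (`) (shift k) ` Q)"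
proof -
  have UQ: "\<Union>Q = nodes l" and UP: "\<Union>P = nodes k" using assms by (auto simp: partition_on_def)
  have "partition_on (shift k ` nodes l) ((`) (shift k) ` Q - {{}})"
    by (rule partition_on_inj_image[OF assms(2)]) (rule inj_on_subset[OF inj_shift], simp)
  moreover have "(`) (shift k) ` Q - {{}} = (`) (shift k) ` Q"
    using assms(2) by (auto simp: partition_on_def)
  ultimately have Q': "partition_on (shift k ` nodes l) ((`) (shift k) ` Q)" by simp
  have dj: "nodes k \<inter> shift k ` nodes l = {}" by (auto dest: shift_notin_nodes)
  show ?thesis
  proof (rule partition_onI)
    show "\<Union> (P \<union> (`) (shift k) ` Q) = nodes (k + l)"
      unfolding nodes_add Union_Un_distrib UP by (simp add: UQ flip: image_Union)
    show "{} \<notin> P \<union> (`) (shift k) ` Q"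
      using assms(1) Q' by (auto simp: partition_on_def)
    fix p q assume *: "p \<in> P \<union> (`) (shift k) ` Q" "q \<in> P \<union> (`) (shift k) ` Q" "p \<noteq> q"
    have a: "x \<subseteq> nodes k" if "x \<in> P" for x using that UP by auto
    have b: "x \<subseteq> shift k ` nodes l" if "x \<in> (`) (shift k) ` Q" for x using that UQ by auto
    consider "p \<in> P" "q \<in> P" | "p \<in> (`) (shift k) ` Q" "q \<in> (`) (shift k) ` Q"
      | "p \<in> P" "q \<in> (`) (shift k) ` Q" | "q \<in> P" "p \<in> (`) (shift k) ` Q" using * by blast
    then show "disjnt p q"
    proof cases
      case 1 then show ?thesis using assms(1) *(3) by (auto simp: partition_on_def pairwise_def)
    next
      case 2 then show ?thesis using Q' *(3) by (metis partition_onD2 pairwise_def)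
    next
      case 3 then show ?thesis using a[of p] b[of q] dj by (auto simp: disjnt_def)
    next
      case 4 then show ?thesis using a[of q] b[of p] dj unfolding disjnt_def by blast
    qed
  qed
qed

text \<open>The monoid of diagrams is written additively, so that finitely supported functions on it
  carry the monoid algebra structure: \<open>0\<close> is $\varnothing$ and \<open>\<pi> + \<rho>\<close> is
  $\pi \otimes \rho$.\<close>

instantiation pdiag :: monoid_add
begin

lift_definition zero_pdiag :: pdiag is "(0, {})"
  by (simp add: partition_on_empty)

lift_definition plus_pdiag :: "pdiag \<Rightarrow> pdiag \<Rightarrow> pdiag" is
  "\<lambda>(k, P) (l, Q). (k + l, P \<union> (`) (shift k) ` Q)"
  by (auto intro: partition_on_tensor)

instance
proof
  fix a b c :: pdiag
  show "a + b + c = a + (b + c)"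
    by transfer (auto simp: image_Un image_image shift_shift add.assoc)
  show "0 + a = a" by transfer auto
  show "a + 0 = a" by transfer auto
qed

end

lemma order_0 [simp]: "order 0 = 0"
  by transfer simp

lemma blocks_0 [simp]: "blocks 0 = {}"
  by transfer simp

lemma order_add [simp]: "order (\<pi> + \<rho>) = order \<pi> + order \<rho>"
  by transfer auto

lemma blocks_add: "blocks (\<pi> + \<rho>) = blocks \<pi> \<union> (`) (shift (order \<pi>)) ` blocks \<rho>"
  by transfer auto

lemma order_eq_0_iff [simp]: "order \<pi> = 0 \<longleftrightarrow> \<pi> = 0"
  by transfer (auto simp: partition_on_empty)

lemma order_pos_iff [simp]: "0 < order \<pi> \<longleftrightarrow> \<pi> \<noteq> 0"
  using order_eq_0_iff[of \<pi>] by linarith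

definition tensor_irreducible :: "pdiag \<Rightarrow> bool" where
  "tensor_irreducible \<pi> \<longleftrightarrow> \<not> (\<exists>\<rho>\<^sub>1 \<rho>\<^sub>2. \<rho>\<^sub>1 \<noteq> 0 \<and> \<rho>\<^sub>2 \<noteq> 0 \<and> \<pi> = \<rho>\<^sub>1 + \<rho>\<^sub>2)"

subsection \<open>The bullet product\<close>

definition merge_blocks :: "node \<Rightarrow> node \<Rightarrow> node set set \<Rightarrow> node set set" where
  "merge_blocks u v R =
     {B \<in> R. u \<notin> B \<and> v \<notin> B} \<union> {\<Union>{B \<in> R. u \<in> B \<or> v \<in> B}}"

lemma partition_on_merge_blocks:
  assumes "partition_on A R" "u \<in> A"
  shows "partition_on A (merge_blocks u v R)"
proof (rule partition_onI)
  have UR: "\<Union>R = A" and dj: "disjoint R" and ne: "{} \<notin> R" using assms by (auto simp: partition_on_def)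
  show "\<Union>(merge_blocks u v R) = A" using UR unfolding merge_blocks_def by auto
  show "{} \<notin> merge_blocks u v R" using UR ne assms(2) unfolding merge_blocks_def by blast
  have key: "disjnt p (\<Union>{B \<in> R. u \<in> B \<or> v \<in> B})" if "p \<in> R" "u \<notin> p" "v \<notin> p" for p
    unfolding disjnt_Union2
  proof
    fix B assume "B \<in> {B \<in> R. u \<in> B \<or> v \<in> B}"
    then show "disjnt p B" using dj that unfolding pairwise_def by blast
  qed
  show "disjnt p q" if "p \<in> merge_blocks u v R" "q \<in> merge_blocks u v R" "p \<noteq> q" for p q
    using that key dj unfolding merge_blocks_def pairwise_def
    by (auto simp: disjnt_sym simp del: disjnt_Union2 disjnt_Union1)
qed

lift_definition bullet :: "pdiag \<Rightarrow> pdiag \<Rightarrow> pdiag" (infixr \<open>\<bullet>\<close> 70) is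
  "\<lambda>(k, P) (l, Q). if k = 0 then (l, Q) else if l = 0 then (k, P)
     else (k + l, merge_blocks (Bot k) (Bot (k + 1)) (P \<union> (`) (shift k) ` Q))"
  by (auto intro!: partition_on_merge_blocks partition_on_tensor split: if_splits)

lemma bullet_0_left [simp]: "0 \<bullet> \<rho> = \<rho>"
  by transfer auto

lemma bullet_0_right [simp]: "\<pi> \<bullet> 0 = \<pi>"
  by transfer (auto simp: partition_on_empty)

lemma blocks_bullet:
  "\<pi> \<noteq> 0 \<Longrightarrow> \<rho> \<noteq> 0 \<Longrightarrow>
    blocks (\<pi> \<bullet> \<rho>) = merge_blocks (Bot (order \<pi>)) (Bot (order \<pi> + 1)) (blocks (\<pi> + \<rho>))"
  unfolding order_eq_0_iff[symmetric] by transfer auto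

lemma order_bullet [simp]: "order (\<pi> \<bullet> \<rho>) = order \<pi> + order \<rho>"
  by transfer auto

lemma finite_order_le: "finite {\<pi>. order \<pi> \<le> n}"
proof (rule finite_imageD)
  show "inj_on (\<lambda>\<pi>. (order \<pi>, blocks \<pi>)) {\<pi>. order \<pi> \<le> n}"
    by (auto intro!: inj_onI pdiag_eqI)
  have "(\<lambda>\<pi>. (order \<pi>, blocks \<pi>)) ` {\<pi>. order \<pi> \<le> n}
      \<subseteq> (SIGMA k : {..n}. {P. partition_on (nodes k) P})"
    using partition_on_blocks by auto
  then show "finite ((\<lambda>\<pi>. (order \<pi>, blocks \<pi>)) ` {\<pi>. order \<pi> \<le> n})"
    by (rule finite_subset) (auto intro!: finite_SigmaI finitely_many_partition_on)
qed

definition irreducible_splittings :: "pdiag \<Rightarrow> (pdiag \<times> pdiag) set" where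
  "irreducible_splittings \<pi> = {(G\<^sub>1, G\<^sub>2).
     (G\<^sub>1 = 0 \<or> tensor_irreducible G\<^sub>1) \<and> (G\<^sub>2 = 0 \<or> tensor_irreducible G\<^sub>2) \<and> G\<^sub>1 \<bullet> G\<^sub>2 = \<pi>}"

text \<open>The bullet product is associative with neutral element \<open>0\<close>, so the bracketing chosen by
  \<^const>\<open>foldr\<close> is immaterial.\<close>

definition bullet_factorizations :: "pdiag \<Rightarrow> pdiag list set" where
  "bullet_factorizations \<pi> = {\<rho>s. 0 \<notin> set \<rho>s \<and> foldr (\<bullet>) \<rho>s 0 = \<pi>}"

lemma finite_irreducible_splittings: "finite (irreducible_splittings \<pi>)"
proof (rule finite_subset)
  show "irreducible_splittings \<pi> \<subseteq> {\<rho>. order \<rho> \<le> order \<pi>} \<times> {\<rho>. order \<rho> \<le> order \<pi>}"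
    by (auto simp: irreducible_splittings_def)
qed (intro finite_cartesian_product finite_order_le)

lemma finite_bullet_factorizations: "finite (bullet_factorizations \<pi>)"
proof (rule finite_subset)
  have "length \<rho>s \<le> order (foldr (\<bullet>) \<rho>s 0) \<and> (\<forall>\<rho>\<in>set \<rho>s. order \<rho> \<le> order (foldr (\<bullet>) \<rho>s 0))"
    if "0 \<notin> set \<rho>s" for \<rho>s
    using that
  proof (induction \<rho>s)
    case (Cons \<rho> \<rho>s)
    then have "0 < order \<rho>" by simp
    with Cons.prems Cons.IH show ?case
      by (auto simp del: order_pos_iff intro: trans_le_add2)
  qed simp
  then show "bullet_factorizations \<pi> \<subseteq>
      {xs. set xs \<subseteq> {\<rho>. order \<rho> \<le> order \<pi>} \<and> length xs \<le> order \<pi>}"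
    unfolding bullet_factorizations_def by fastforce
  show "finite {xs. set xs \<subseteq> {\<rho>. order \<rho> \<le> order \<pi>} \<and> length xs \<le> order \<pi>}"
    by (intro finite_lists_length_le finite_order_le)
qed

subsection \<open>Unique factorization\<close>

lemma block_nonempty: "B \<in> blocks \<pi> \<Longrightarrow> \<exists>x. x \<in> B"
  using partition_on_blocks[of \<pi>] by (metis partition_onD3 all_not_in_conv)

lemma block_nodes: "B \<in> blocks \<pi> \<Longrightarrow> x \<in> B \<Longrightarrow> x \<in> nodes (order \<pi>)"
  using partition_on_blocks[of \<pi>] by (auto simp: partition_on_def)

lemma node_in_block: "x \<in> nodes (order \<pi>) \<Longrightarrow> \<exists>B \<in> blocks \<pi>. x \<in> B"
  using partition_on_blocks[of \<pi>] by (auto simp: partition_on_def)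

lemma tensor_equidivisible:
  fixes a b c d :: pdiag
  assumes eq: "a + b = c + d" and le: "order a \<le> order c"
  shows "\<exists>e. c = a + e \<and> b = e + d"
proof -
  define k where "k = order a"
  define k' where "k' = order c"
  have kk: "k \<le> k'" using le by (simp add: k_def k'_def)
  define m where "m = k' - k"
  have k': "k' = k + m" using kk by (simp add: m_def)
  define R where "R = blocks (a + b)"
  have R1: "R = blocks a \<union> (`) (shift k) ` blocks b" by (simp add: R_def blocks_add k_def)
  have R2: "R = blocks c \<union> (`) (shift k') ` blocks d" by (simp add: R_def eq blocks_add k'_def)
  have ord: "order b = m + order d"
    using arg_cong[OF eq, of order] k' by (simp add: k_def k'_def)
  have inj: "B = C" if "shift k ` B = shift k ` C" for B C
    using that inj_image_eq_iff[OF inj_shift] by blast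
  have sh: "shift k' ` C = shift k ` shift m ` C" for C
    by (simp add: image_image shift_shift k')
  have no1: "shift k' ` C \<noteq> B" if "C \<in> blocks d" "B \<in> blocks a" for B C
    using block_nonempty[OF that(1)] block_nodes[OF that(1)] block_nodes[OF that(2)] kk k_def
    by (metis imageI shift_notin_nodes')
  have no2: "shift k' ` C \<noteq> B" if "C \<in> blocks d" "B \<in> blocks c" for B C
    using block_nonempty[OF that(1)] block_nodes[OF that(1)] block_nodes[OF that(2)] k'_def
    by (metis imageI shift_notin_nodes)
  define E where "E = {B \<in> blocks b. shift k ` B \<in> blocks c}"
  have E_b: "blocks b = E \<union> (`) (shift m) ` blocks d"
  proof (intro equalityI subsetI)
    fix B assume B: "B \<in> blocks b"
    then have "shift k ` B \<in> R" by (auto simp: R1)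
    then consider "shift k ` B \<in> blocks c" | C where "C \<in> blocks d" "shift k ` B = shift k' ` C"
      unfolding R2 by blast
    then show "B \<in> E \<union> (`) (shift m) ` blocks d"
    proof cases
      case 1 then show ?thesis using B by (simp add: E_def)
    next
      case 2 then show ?thesis using inj[of B "shift m ` C"] by (simp add: sh)
    qed
  next
    fix B assume "B \<in> E \<union> (`) (shift m) ` blocks d"
    then consider "B \<in> E" | C where "C \<in> blocks d" "B = shift m ` C" by blast
    then show "B \<in> blocks b"
    proof cases
      case 1 then show ?thesis by (simp add: E_def)
    next
      case 2
      then have "shift k' ` C \<in> R" by (auto simp: R2)
      then have "shift k' ` C \<in> (`) (shift k) ` blocks b" using no1 2(1) unfolding R1 by blast
      then obtain B' where "B' \<in> blocks b" "shift k' ` C = shift k ` B'" by blast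
      then show ?thesis using inj[of "shift m ` C" B'] 2 by (simp add: sh)
    qed
  qed
  have E_c: "blocks c = blocks a \<union> (`) (shift k) ` E"
  proof (intro equalityI subsetI)
    fix B assume B: "B \<in> blocks c"
    then have "B \<in> R" by (simp add: R2)
    then show "B \<in> blocks a \<union> (`) (shift k) ` E" using B unfolding R1 E_def by blast
  next
    fix B assume "B \<in> blocks a \<union> (`) (shift k) ` E"
    moreover have "B \<in> blocks c" if "B \<in> blocks a"
    proof -
      have "B \<in> R" using that by (simp add: R1)
      then show ?thesis using no1 that unfolding R2 by blast
    qed
    ultimately show "B \<in> blocks c" unfolding E_def by blast
  qed
  have UE: "\<Union>E = nodes m"
  proof (intro equalityI subsetI)
    fix x assume "x \<in> \<Union>E"
    then obtain B where B: "x \<in> B" "B \<in> blocks b" "shift k ` B \<in> blocks c" by (auto simp: E_def)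
    have "shift k x \<in> nodes k'" using B block_nodes unfolding k'_def by blast
    then show "x \<in> nodes m" unfolding m_def using B block_nodes shift_in_nodes_diff by blast
  next
    fix x assume x: "x \<in> nodes m"
    then have "shift k x \<in> nodes (order c)"
      using shift_in_nodes[of x m k] k' by (simp add: k'_def)
    then obtain B where B: "B \<in> blocks c" "shift k x \<in> B" using node_in_block by blast
    have "B \<notin> blocks a" using block_nodes[of B a] B(2) shift_notin_nodes[OF x] k_def by blast
    then obtain B' where "B' \<in> E" "B = shift k ` B'" using B(1) unfolding E_c by blast
    then show "x \<in> \<Union>E" using B(2) inj_shift[of k] by (auto dest: injD)
  qed
  have PE: "partition_on (nodes m) E"
  proof (rule partition_onI[OF UE])
    have "disjoint (blocks b)" "{} \<notin> blocks b"
      using partition_on_blocks[of b] by (auto simp: partition_on_def)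
    then show "{} \<notin> E" "\<And>p q. p \<in> E \<Longrightarrow> q \<in> E \<Longrightarrow> p \<noteq> q \<Longrightarrow> disjnt p q"
      by (auto simp: E_def pairwise_def)
  qed
  define e where "e = Abs_pdiag (m, E)"
  have e: "order e = m" "blocks e = E"
    using PE by (simp_all add: e_def order.rep_eq blocks.rep_eq Abs_pdiag_inverse)
  have "c = a + e"
    by (rule pdiag_eqI) (use k' E_c in \<open>auto simp: e blocks_add k_def k'_def\<close>)
  moreover have "b = e + d"
    by (rule pdiag_eqI) (use E_b ord in \<open>auto simp: e blocks_add\<close>)
  ultimately show ?thesis by blast
qed

lemma tensor_eq_imp:
  fixes a b c d :: pdiag
  assumes "a + b = c + d" "order a = order c"
  shows "a = c \<and> b = d"
proof -
  obtain e where e: "c = a + e" "b = e + d" using tensor_equidivisible[of a b c d] assms by auto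
  then have "order e = 0" using assms(2) by simp
  then show ?thesis using e by simp
qed

definition irreducible_list :: "pdiag list \<Rightarrow> bool" where
  "irreducible_list xs \<longleftrightarrow> (\<forall>x \<in> set xs. x \<noteq> 0 \<and> tensor_irreducible x)"

lemma irreducible_list_exists: "\<exists>xs. irreducible_list xs \<and> sum_list xs = \<pi>"
proof (induction "order \<pi>" arbitrary: \<pi> rule: less_induct)
  case less
  consider "\<pi> = 0" | "\<pi> \<noteq> 0" "tensor_irreducible \<pi>"
    | \<rho> \<sigma> where "\<rho> \<noteq> 0" "\<sigma> \<noteq> 0" "\<pi> = \<rho> + \<sigma>"
    unfolding tensor_irreducible_def by blast
  then show ?case
  proof cases
    case 1 then show ?thesis by (intro exI[of _ "[]"]) (simp add: irreducible_list_def)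
  next
    case 2 then show ?thesis by (intro exI[of _ "[\<pi>]"]) (simp add: irreducible_list_def)
  next
    case 3
    then have "order \<rho> < order \<pi>" "order \<sigma> < order \<pi>" by auto
    then obtain xs ys where "irreducible_list xs" "sum_list xs = \<rho>"
        "irreducible_list ys" "sum_list ys = \<sigma>"
      using less by metis
    then show ?thesis using 3
      by (intro exI[of _ "xs @ ys"]) (auto simp: irreducible_list_def)
  qed
qed

lemma irreducible_list_unique:
  "irreducible_list xs \<Longrightarrow> irreducible_list ys \<Longrightarrow> sum_list xs = sum_list ys \<Longrightarrow> xs = ys"
proof (induction xs arbitrary: ys)
  case Nil
  show ?case
  proof (cases ys)
    case (Cons y zs)
    then have "order y + order (sum_list zs) = 0" 

      using Nil Cons by (metis order_0 order_add sum_list.Cons sum_list.Nil)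
    then show ?thesis using Nil Cons by (simp add: irreducible_list_def)
  qed simp
next
  case (Cons x xs)
  show ?case
  proof (cases ys)
    case Nil
    then have "order x + order (sum_list xs) = 0" 

      using Cons by (metis order_0 order_add sum_list.Cons sum_list.Nil)
    then show ?thesis using Cons by (simp add: irreducible_list_def)
  next
    case ys: (Cons y zs)
    have eq: "x + sum_list xs = y + sum_list zs" using Cons.prems ys by simp
    have irr: "x \<noteq> 0" "tensor_irreducible x" "y \<noteq> 0" "tensor_irreducible y"
      using Cons.prems ys by (auto simp: irreducible_list_def)
    have "order x = order y"
    proof (cases "order x \<le> order y")
      case True
      then obtain e where "y = x + e" using tensor_equidivisible[OF eq] by blast
      then show ?thesis using irr unfolding tensor_irreducible_def by fastforce
    next
      case False
      then obtain e where "x = y + e" using tensor_equidivisible[OF eq[symmetric]] by auto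
      then show ?thesis using irr unfolding tensor_irreducible_def by fastforce
    qed
    then have "x = y" "sum_list xs = sum_list zs" using tensor_eq_imp[OF eq] by auto
    then show ?thesis using Cons ys by (auto simp: irreducible_list_def)
  qed
qed

definition factors :: "pdiag \<Rightarrow> pdiag list" where
  "factors \<pi> = (THE xs. irreducible_list xs \<and> sum_list xs = \<pi>)"

lemma factors: "irreducible_list (factors \<pi>)" "sum_list (factors \<pi>) = \<pi>"
proof -
  have "\<exists>!xs. irreducible_list xs \<and> sum_list xs = \<pi>"
    using irreducible_list_exists irreducible_list_unique by metis
  from theI'[OF this] show "irreducible_list (factors \<pi>)" "sum_list (factors \<pi>) = \<pi>"
    unfolding factors_def by auto
qed

lemma factors_eqI: "irreducible_list xs \<Longrightarrow> sum_list xs = \<pi> \<Longrightarrow> factors \<pi> = xs"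
  using factors irreducible_list_unique by metis

lemma factors_0: "factors 0 = []"
  by (rule factors_eqI) (simp_all add: irreducible_list_def)

lemma factors_irreducible: "\<pi> \<noteq> 0 \<Longrightarrow> tensor_irreducible \<pi> \<Longrightarrow> factors \<pi> = [\<pi>]"
  by (rule factors_eqI) (simp_all add: irreducible_list_def)

lemma factors_add: "factors (\<pi> + \<rho>) = factors \<pi> @ factors \<rho>"
  by (rule factors_eqI) (use factors in \<open>auto simp: irreducible_list_def\<close>)

lemma pdiag_induct [case_names zero irreducible tensor]:
  assumes "P 0" "\<And>\<pi>. \<pi> \<noteq> 0 \<Longrightarrow> tensor_irreducible \<pi> \<Longrightarrow> P \<pi>"
    and "\<And>\<pi> \<rho>. P \<pi> \<Longrightarrow> P \<rho> \<Longrightarrow> P (\<pi> + \<rho>)"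
  shows "P \<pi>"
proof -
  have "P (sum_list xs)" if "irreducible_list xs" for xs
    using that by (induction xs) (auto simp: irreducible_list_def intro: assms)
  then show ?thesis using factors by metis
qed

section \<open>The Hopf algebra ParSym\<close>

abbreviation "keys \<equiv> Poly_Mapping.keys"
abbreviation "lookup \<equiv> Poly_Mapping.lookup"

definition pscale :: "'k::field \<Rightarrow> ('a \<Rightarrow>\<^sub>0 'k) \<Rightarrow> 'a \<Rightarrow>\<^sub>0 'k" where
  "pscale c x = Poly_Mapping.map ((*) c) x"

lemma lookup_pscale [simp]: "lookup (pscale c x) i = c * lookup x i"
  by (simp add: pscale_def Poly_Mapping.map.rep_eq when_def)

global_interpretation pm: vector_space pscale
  by unfold_locales (auto intro!: poly_mapping_eqI simp: lookup_add algebra_simps)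

text \<open>The product on \<open>'k parsym\<close> is the convolution product of
  \<^theory>\<open>HOL-Library.Poly_Mapping\<close>; see \<open>H_0\<close> and \<open>H_mult\<close> below.\<close>

type_synonym 'k parsym = "pdiag \<Rightarrow>\<^sub>0 'k"

text \<open>\<open>ParSym \<otimes> ParSym\<close> has the basis \<open>H \<pi> \<otimes> H \<rho>\<close>, indexed by pairs of diagrams; the
  componentwise monoid structure on pairs gives the usual product of the tensor square
  (\<open>tens_mult\<close>).\<close>

type_synonym 'k parsym2 = "(pdiag \<times> pdiag) \<Rightarrow>\<^sub>0 'k"

definition H :: "pdiag \<Rightarrow> 'k::field parsym" where
  "H \<pi> = Poly_Mapping.single \<pi> 1"

definition tens :: "'k::field parsym \<Rightarrow> 'k parsym \<Rightarrow> 'k parsym2" where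
  "tens x y = (\<Sum>\<pi> \<in> keys x. \<Sum>\<rho> \<in> keys y. Poly_Mapping.single (\<pi>, \<rho>) (lookup x \<pi> * lookup y \<rho>))"

lemma H_0: "H 0 = 1"
  by (simp add: H_def)

lemma H_mult: "H \<pi> * H \<rho> = H (\<pi> + \<rho>)"
  by (simp add: H_def mult_single)

lemma tens_H: "tens (H \<pi>) (H \<rho>) = Poly_Mapping.single (\<pi>, \<rho>) 1"
  by (simp add: tens_def H_def)

lemma lookup_tens: "lookup (tens x y) (\<pi>, \<rho>) = lookup x \<pi> * lookup y \<rho>"
proof -
  have "lookup (tens x y) (\<pi>, \<rho>) = (\<Sum>\<pi>' \<in> keys x. \<Sum>\<rho>' \<in> keys y.
      if \<rho>' = \<rho> then if \<pi>' = \<pi> then lookup x \<pi> * lookup y \<rho> else 0 else 0)"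
    by (auto simp: tens_def lookup_sum lookup_single when_def intro!: sum.cong)
  also have "\<dots> = (\<Sum>\<pi>' \<in> keys x. if \<pi>' = \<pi> then lookup x \<pi> * lookup y \<rho> else 0)"
    by (rule sum.cong) (simp_all add: sum.delta in_keys_iff)
  also have "\<dots> = lookup x \<pi> * lookup y \<rho>"
    by (simp add: sum.delta in_keys_iff)
  finally show ?thesis .
qed

lemma tens_linear_left: "Vector_Spaces.linear pscale pscale (\<lambda>x. tens x y)"
  by (rule linear_module_homI, unfold_locales)
    (auto intro!: poly_mapping_eqI simp: lookup_tens lookup_add algebra_simps)

lemma tens_linear_right: "Vector_Spaces.linear pscale pscale (tens x)"
  by (rule linear_module_homI, unfold_locales)
    (auto intro!: poly_mapping_eqI simp: lookup_tens lookup_add algebra_simps)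

definition tensor_square :: "'k::field parsym set \<Rightarrow> 'k parsym2 set" where
  "tensor_square V = pm.span {tens x y | x y. x \<in> V \<and> y \<in> V}"

definition is_comult :: "('k::field parsym \<Rightarrow> 'k parsym2) \<Rightarrow> bool" where
  "is_comult D \<longleftrightarrow>
     Vector_Spaces.linear pscale pscale D \<and>
     (\<forall>x y. D (x * y) = D x * D y) \<and>
     D (H 0) = tens (H 0) (H 0) \<and>
     (\<forall>\<pi>. \<pi> \<noteq> 0 \<longrightarrow> tensor_irreducible \<pi> \<longrightarrow>
        D (H \<pi>) = (\<Sum>(G\<^sub>1, G\<^sub>2) \<in> irreducible_splittings \<pi>. tens (H G\<^sub>1) (H G\<^sub>2)))"

definition is_antipode :: "('k::field parsym \<Rightarrow> 'k parsym) \<Rightarrow> bool" where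
  "is_antipode T \<longleftrightarrow>
     Vector_Spaces.linear pscale pscale T \<and>
     (\<forall>x y. T (x * y) = T y * T x) \<and>
     T (H 0) = H 0 \<and>
     (\<forall>\<pi>. \<pi> \<noteq> 0 \<longrightarrow> tensor_irreducible \<pi> \<longrightarrow>
        T (H \<pi>) = (\<Sum>\<rho>s \<in> bullet_factorizations \<pi>.
          pscale ((- 1) ^ length \<rho>s) (prod_list (map H \<rho>s))))"

text \<open>The descriptions below denote: see \<open>ex1_is_comult\<close> and \<open>ex1_is_antipode\<close>, which rest on
  unique factorization into \<open>\<otimes>\<close>-irreducible diagrams.\<close>

definition comult :: "'k::field parsym \<Rightarrow> 'k parsym2" where
  "comult = (THE D. is_comult D)"

definition antipode :: "'k::field parsym \<Rightarrow> 'k parsym" where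
  "antipode = (THE T. is_antipode T)"

subsection \<open>Well-definedness of the coproduct and the antipode\<close>

definition linext :: "('a \<Rightarrow> ('b \<Rightarrow>\<^sub>0 'k)) \<Rightarrow> ('a \<Rightarrow>\<^sub>0 'k) \<Rightarrow> ('b \<Rightarrow>\<^sub>0 'k::field)" where
  "linext f x = (\<Sum>a \<in> keys x. pscale (lookup x a) (f a))"

lemma linext_superset:
  assumes "finite A" "keys x \<subseteq> A"
  shows "linext f x = (\<Sum>a \<in> A. pscale (lookup x a) (f a))"
  unfolding linext_def
  by (rule sum.mono_neutral_left) (use assms in \<open>auto simp: not_in_keys_iff_lookup_eq_zero\<close>)

lemma linext_single: "linext f (Poly_Mapping.single a c) = pscale c (f a)"
  by (subst linext_superset[of "{a}"]) auto

lemma linear_linext: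
  fixes f :: "'a \<Rightarrow> ('b \<Rightarrow>\<^sub>0 'k::field)"
  shows "Vector_Spaces.linear pscale pscale (linext f)"
proof (rule linear_module_homI, unfold_locales)
  fix x y :: "'a \<Rightarrow>\<^sub>0 'k" and c :: 'k
  let ?A = "keys x \<union> keys y"
  have A: "finite ?A" "keys (x + y) \<subseteq> ?A" "keys (pscale c x) \<subseteq> ?A" "keys x \<subseteq> ?A" "keys y \<subseteq> ?A"
    using keys_add[of x y] by (auto simp: in_keys_iff)
  show "linext f (x + y) = linext f x + linext f y"
    by (simp add: linext_superset[OF A(1,2)] linext_superset[OF A(1,4)] linext_superset[OF A(1,5)]
        lookup_add pm.scale_left_distrib sum.distrib)
  show "linext f (pscale c x) = pscale c (linext f x)"
    by (simp add: linext_superset[OF A(1,3)] linext_superset[OF A(1,4)] pm.scale_sum_right)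
qed

lemma poly_mapping_decompose: "x = (\<Sum>a \<in> keys x. pscale (lookup x a) (Poly_Mapping.single a 1))"
proof (rule poly_mapping_eqI)
  show "lookup x i = lookup (\<Sum>a\<in>keys x. pscale (lookup x a) (Poly_Mapping.single a 1)) i" for i
    by (simp add: lookup_sum lookup_single when_def if_distrib[of "(*) _"] in_keys_iff
        cong: if_cong)
qed

lemma linear_eq_on_basis:
  assumes "Vector_Spaces.linear pscale pscale f" "Vector_Spaces.linear pscale pscale g"
    and "\<And>a. f (Poly_Mapping.single a 1) = g (Poly_Mapping.single a 1)"
  shows "f x = g x"
proof -
  interpret f: Vector_Spaces.linear pscale pscale f by fact
  interpret g: Vector_Spaces.linear pscale pscale g by fact
  show ?thesis
    by (subst (1 2) poly_mapping_decompose) (simp add: f.sum g.sum f.scale g.scale assms(3))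
qed

lemma pscale_eq_mult: "pscale c x = Poly_Mapping.single 0 c * x" for x :: "'a::monoid_add \<Rightarrow>\<^sub>0 'k::field"
  by (simp add: pscale_def mult_map_scale_conv_mult)

lemma pscale_mult_left: "pscale c x * y = pscale c (x * y)" for x :: "'a::monoid_add \<Rightarrow>\<^sub>0 'k::field"
  by (simp add: pscale_eq_mult mult.assoc)

lemma pscale_mult_right: "x * pscale c y = pscale c (x * y)" for x :: "'a::monoid_add \<Rightarrow>\<^sub>0 'k::field"
proof -
  have lin: "Vector_Spaces.linear pscale pscale (\<lambda>x. x * pscale c y)"
    by (rule linear_module_homI, unfold_locales) (simp_all add: algebra_simps pscale_mult_left)
  have lin': "Vector_Spaces.linear pscale pscale (\<lambda>x. pscale c (x * y))"
    by (rule linear_module_homI, unfold_locales)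
      (simp_all add: distrib_right pm.scale_right_distrib pscale_mult_left pm.scale_left_commute)
  have "Poly_Mapping.single a 1 * pscale c y = pscale c (Poly_Mapping.single a 1 * y)" for a
    by (simp add: pscale_eq_mult mult.assoc[symmetric] mult_single)
  then show ?thesis using linear_eq_on_basis[OF lin lin'] by blast
qed

lemma linear_mult_right: "Vector_Spaces.linear pscale pscale (\<lambda>x. x * y)"
  for y :: "'a::monoid_add \<Rightarrow>\<^sub>0 'k::field"
  by (rule linear_module_homI, unfold_locales) (simp_all add: distrib_right pscale_mult_left)

lemma linear_mult_left: "Vector_Spaces.linear pscale pscale (\<lambda>x. y * x)"
  for y :: "'a::monoid_add \<Rightarrow>\<^sub>0 'k::field"
  by (rule linear_module_homI, unfold_locales) (simp_all add: distrib_left pscale_mult_right)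

lemmas linear_comp = Vector_Spaces.linear_compose[unfolded comp_def]

lemma linear_morphism_on_basis:
  fixes f :: "'k::field parsym \<Rightarrow> ('b::monoid_add \<Rightarrow>\<^sub>0 'k)"
  assumes lin: "Vector_Spaces.linear pscale pscale f"
    and basis: "\<And>\<pi> \<rho>. f (H (\<pi> + \<rho>)) = f (H \<pi>) * f (H \<rho>)"
  shows "f (x * y) = f x * f y"
proof -
  have 1: "f (x * H \<rho>) = f x * f (H \<rho>)" for x \<rho>
    by (rule linear_eq_on_basis[OF linear_comp[OF linear_mult_right lin]
          linear_comp[OF lin linear_mult_right]])
      (use basis in \<open>simp add: H_def mult_single\<close>)
  show ?thesis
    by (rule linear_eq_on_basis[OF linear_comp[OF linear_mult_left lin]
          linear_comp[OF lin linear_mult_left]])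
      (use 1 in \<open>simp add: H_def\<close>)
qed

lemma linear_antimorphism_on_basis:
  fixes f :: "'k::field parsym \<Rightarrow> ('b::monoid_add \<Rightarrow>\<^sub>0 'k)"
  assumes lin: "Vector_Spaces.linear pscale pscale f"
    and basis: "\<And>\<pi> \<rho>. f (H (\<pi> + \<rho>)) = f (H \<rho>) * f (H \<pi>)"
  shows "f (x * y) = f y * f x"
proof -
  have 1: "f (x * H \<rho>) = f (H \<rho>) * f x" for x \<rho>
    by (rule linear_eq_on_basis[OF linear_comp[OF linear_mult_right lin]
          linear_comp[OF lin linear_mult_left]])
      (use basis in \<open>simp add: H_def mult_single\<close>)
  show ?thesis
    by (rule linear_eq_on_basis[OF linear_comp[OF linear_mult_left lin]
          linear_comp[OF lin linear_mult_right]])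
      (use 1 in \<open>simp add: H_def\<close>)
qed

lemma tens_mult: "tens a b * tens c d = tens (a * c) (b * d)"
proof -
  note lin = linear_comp[OF tens_linear_left linear_mult_right] linear_comp[OF tens_linear_right linear_mult_right]
    linear_comp[OF tens_linear_left linear_mult_left] linear_comp[OF tens_linear_right linear_mult_left]
    linear_comp[OF linear_mult_right tens_linear_left] linear_comp[OF linear_mult_right tens_linear_right]
    linear_comp[OF linear_mult_left tens_linear_left] linear_comp[OF linear_mult_left tens_linear_right]
  have 1: "tens (H \<pi>) (H \<rho>) * tens (H \<sigma>) (H \<tau>) = tens (H \<pi> * H \<sigma>) (H \<rho> * H \<tau>)" for \<pi> \<rho> \<sigma> \<tau>
    by (simp add: H_mult tens_H mult_single)
  have 2: "tens a (H \<rho>) * tens (H \<sigma>) (H \<tau>) = tens (a * H \<sigma>) (H \<rho> * H \<tau>)" for a \<rho> \<sigma> \<tau>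
    by (rule linear_eq_on_basis[OF lin(1) lin(5)]) (use 1 in \<open>simp add: H_def\<close>)
  have 3: "tens a b * tens (H \<sigma>) (H \<tau>) = tens (a * H \<sigma>) (b * H \<tau>)" for a b \<sigma> \<tau>
    by (rule linear_eq_on_basis[OF lin(2) lin(6)]) (use 2 in \<open>simp add: H_def\<close>)
  have 4: "tens a b * tens c (H \<tau>) = tens (a * c) (b * H \<tau>)" for a b c \<tau>
    by (rule linear_eq_on_basis[OF lin(3) lin(7)]) (use 3 in \<open>simp add: H_def\<close>)
  show ?thesis
    by (rule linear_eq_on_basis[OF lin(4) lin(8)]) (use 4 in \<open>simp add: H_def\<close>)
qed

lemma linext_H: "linext f (H \<pi>) = f \<pi>"
  by (simp add: H_def linext_single)

lemma tens_H_0: "tens (H 0) (H 0) = 1"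
  by (simp add: tens_H flip: zero_prod_def)

lemma ex1_is_comult: "\<exists>!D :: 'k::field parsym \<Rightarrow> 'k parsym2. is_comult D"
proof (rule ex_ex1I)
  let ?g = "\<lambda>\<pi>. \<Sum>(G\<^sub>1, G\<^sub>2) \<in> irreducible_splittings \<pi>. tens (H G\<^sub>1) (H G\<^sub>2) :: 'k parsym2"
  let ?D = "linext (\<lambda>\<pi>. prod_list (map ?g (factors \<pi>)))"
  have "?D (x * y) = ?D x * ?D y" for x y
    by (rule linear_morphism_on_basis[OF linear_linext]) (simp add: linext_H factors_add)
  then have "is_comult ?D"
    by (simp add: is_comult_def linear_linext linext_H factors_0 factors_irreducible tens_H_0)
  then show "\<exists>D :: 'k parsym \<Rightarrow> 'k parsym2. is_comult D" by blast
next
  fix D D' :: "'k parsym \<Rightarrow> 'k parsym2"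
  assume D: "is_comult D" and D': "is_comult D'"
  have "D (H \<pi>) = D' (H \<pi>)" for \<pi>
    by (induction \<pi> rule: pdiag_induct)
      (use D D' in \<open>simp_all add: is_comult_def flip: H_mult\<close>)
  then show "D = D'"
    using D D' linear_eq_on_basis[of D D'] unfolding is_comult_def H_def by blast
qed

lemma is_comult_comult: "is_comult comult"
  unfolding comult_def by (rule theI'[OF ex1_is_comult])

lemma ex1_is_antipode: "\<exists>!T :: 'k::field parsym \<Rightarrow> 'k parsym. is_antipode T"
proof (rule ex_ex1I)
  let ?g = "\<lambda>\<pi>. \<Sum>\<rho>s \<in> bullet_factorizations \<pi>.
    pscale ((- 1) ^ length \<rho>s) (prod_list (map H \<rho>s)) :: 'k parsym"
  let ?T = "linext (\<lambda>\<pi>. prod_list (rev (map ?g (factors \<pi>))))"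
  have "?T (x * y) = ?T y * ?T x" for x y
    by (rule linear_antimorphism_on_basis[OF linear_linext]) (simp add: linext_H factors_add)
  then have "is_antipode ?T"
    unfolding is_antipode_def by (simp add: linear_linext linext_H factors_0 factors_irreducible) (simp add: H_0)
  then show "\<exists>T :: 'k parsym \<Rightarrow> 'k parsym. is_antipode T" by blast
next
  fix T T' :: "'k parsym \<Rightarrow> 'k parsym"
  assume T: "is_antipode T" and T': "is_antipode T'"
  have "T (H \<pi>) = T' (H \<pi>)" for \<pi>
    by (induction \<pi> rule: pdiag_induct)
      (use T T' in \<open>simp_all add: is_antipode_def flip: H_mult\<close>)
  then show "T = T'"
    using T T' linear_eq_on_basis[of T T'] unfolding is_antipode_def H_def by blast
qed

lemma is_antipode_antipode: "is_antipode antipode"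
  unfolding antipode_def by (rule theI'[OF ex1_is_antipode])

subsection \<open>Hopf subalgebras\<close>

definition hopf_subalgebra :: "'k::field parsym set \<Rightarrow> bool" where
  "hopf_subalgebra V \<longleftrightarrow>
     pm.subspace V \<and>
     H 0 \<in> V \<and>
     (\<forall>x \<in> V. \<forall>y \<in> V. x * y \<in> V) \<and>
     comult ` V \<subseteq> tensor_square V \<and>
     antipode ` V \<subseteq> V"

end

theory Submission
  imports Defs
begin

text \<open>If $\sigma \bullet \tau$ is a perfect matching with both factors nonempty, the merged block is
  $\{k', (k+1)'\}$, so $\{k'\}$ is a singleton block of $\sigma$ while all other blocks of $\sigma$
  have size two. Then $\sigma$ has an odd number of vertices, a contradiction. Perfect matchings
  therefore have only trivial \<open>\<bullet>\<close>-factorizations, so irreducible ones are primitive with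
  $S(H_\pi) = -H_\pi$, and the general case follows by multiplicativity.\<close>

lemma card_nodes: "card (nodes k) = 2 * k"
proof -
  have "card (Top ` {1..k}) = k" "card (Bot ` {1..k}) = k"
    by (simp_all add: card_image inj_on_def)
  moreover have "Top ` {1..k} \<inter> Bot ` {1..k} = {}" by auto
  ultimately show ?thesis by (simp add: nodes_def card_Un_disjoint)
qed

lemma perfect_matching_0: "perfect_matching 0"
  by (simp add: perfect_matching_def)

text \<open>Shifts are injective, so block sizes survive. The backward direction gives closure under
  the product; the forward one passes the hypothesis to the factors in the later inductions.\<close>

lemma perfect_matching_add:
  "perfect_matching (\<pi> + \<rho>) \<longleftrightarrow> perfect_matching \<pi> \<and> perfect_matching \<rho>"
proof -
  have "card (shift k ` B) = card B" for k B
    by (rule card_image) (rule inj_on_subset[OF inj_shift], simp)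
  then show ?thesis by (simp add: perfect_matching_def blocks_add ball_Un)
qed

lemma perfect_matching_bullet_trivial:
  assumes pm: "perfect_matching (\<sigma> \<bullet> \<tau>)"
  shows "\<sigma> = 0 \<or> \<tau> = 0"
proof (rule ccontr)
  assume "\<not> ?thesis"
  then have nz: "\<sigma> \<noteq> 0" "\<tau> \<noteq> 0" by auto
  define k where "k = order \<sigma>"
  \<comment> \<open>Positive orders make k' a vertex of \<open>\<sigma>\<close> and (k+1)' a vertex
    of \<open>\<sigma> + \<tau>\<close>.\<close>
  have pos: "1 \<le> k" "1 \<le> order \<tau>"
    using nz by (simp_all add: k_def Suc_le_eq)
  define R where "R = blocks (\<sigma> + \<tau>)"
  \<comment> \<open>\<open>U\<close> is the block created by the merge.\<close>
  define U where "U = \<Union>{B \<in> R. Bot k \<in> B \<or> Bot (k + 1) \<in> B}"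
  have bl: "blocks (\<sigma> \<bullet> \<tau>) = {B \<in> R. Bot k \<notin> B \<and> Bot (k + 1) \<notin> B} \<union> {U}"
    using blocks_bullet[OF nz] by (simp add: merge_blocks_def k_def R_def U_def)
  then have cU: "card U = 2" using pm by (simp add: perfect_matching_def)
  \<comment> \<open>Infinite sets have \<open>card\<close> 0, so \<open>card U = 2\<close> forces
    finiteness.\<close>
  then have finU: "finite U" using card.infinite by fastforce
  obtain B where B: "B \<in> blocks \<sigma>" "Bot k \<in> B"
    using node_in_block[of "Bot k" \<sigma>] pos by (auto simp: k_def)
  obtain C where C: "C \<in> R" "Bot (k + 1) \<in> C"
    using node_in_block[of "Bot (k + 1)" "\<sigma> + \<tau>"] pos by (auto simp: k_def R_def)
  have \<sigma>_sub: "blocks \<sigma> \<subseteq> R" by (simp add: R_def blocks_add)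
  have notin: "Bot (k + 1) \<notin> A" if "A \<in> blocks \<sigma>" for A
    using block_nodes[OF that, of "Bot (k + 1)"] by (auto simp: k_def)
  have "C \<subseteq> U" "B \<subseteq> U"
    unfolding U_def by (rule Union_upper; use B C \<sigma>_sub in auto)+
  then have ins: "insert (Bot (k + 1)) B \<subseteq> U" using C(2) by auto
  have finB: "finite B" using \<open>B \<subseteq> U\<close> finU by (rule finite_subset)
  \<comment> \<open>The vertex (k+1)' lies outside \<open>B\<close> and takes one of the two places
    in \<open>U\<close>, leaving at most one for \<open>B\<close>.\<close>
  have "card (insert (Bot (k + 1)) B) \<le> 2" using card_mono[OF finU ins] cU by simp
  then have "card B \<le> Suc 0" using notin[OF B(1)] finB by simp
  then have Beq: "B = {Bot k}"
    using B(2) card_le_Suc0_iff_eq[OF finB] by blast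
  have part: "\<Union>(blocks \<sigma>) = nodes k" "disjoint (blocks \<sigma>)"
    using partition_on_blocks[of \<sigma>] by (auto simp: partition_on_def k_def)
  have dj: "A \<inter> A' = {}" if "A \<in> blocks \<sigma>" "A' \<in> blocks \<sigma>" "A \<noteq> A'" for A A'
    using part(2) that by (auto simp: pairwise_def disjnt_def)
  have Uni: "\<Union>(blocks \<sigma> - {B}) = nodes k - {Bot k}"
    using dj[OF _ B(1)] B part(1) Beq by blast
  have "card A = 2" if A: "A \<in> blocks \<sigma> - {B}" for A
  proof -
    \<comment> \<open>Avoiding both k' and (k+1)', the block \<open>A\<close> survives the merge
      unchanged.\<close>
    have "Bot k \<notin> A" using dj[of A B] A B by blast
    then have "A \<in> blocks (\<sigma> \<bullet> \<tau>)" using A notin \<sigma>_sub unfolding bl by blast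
    then show ?thesis using pm by (simp add: perfect_matching_def)
  qed
  moreover have "finite (blocks \<sigma>)"
    using part(1) by (metis finite_UnionD finite_nodes)
  ultimately have "2 * card (blocks \<sigma> - {B}) = card (nodes k - {Bot k})"
    using card_partition[of "blocks \<sigma> - {B}" 2] by (simp add: Uni dj)
  also have "\<dots> = 2 * k - 1" using pos by (simp add: card_nodes)
  \<comment> \<open>Since \<open>k \<ge> 1\<close>, the truncated difference
    \<open>2 * k - 1\<close> is genuinely odd, while the left side is even.\<close>
  finally show False using pos(1) by presburger
qed

text \<open>One factor is empty, hence a perfect matching, and the other is the whole
  product.\<close>

lemma perfect_matching_bulletD:
  "perfect_matching (\<sigma> \<bullet> \<tau>) \<Longrightarrow> perfect_matching \<sigma> \<and> perfect_matching \<tau>"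
  using perfect_matching_bullet_trivial[of \<sigma> \<tau>] perfect_matching_0 by auto

lemma perfect_matching_foldr_bulletD:
  "perfect_matching (foldr (\<bullet>) \<rho>s 0) \<Longrightarrow> \<rho> \<in> set \<rho>s \<Longrightarrow> perfect_matching \<rho>"
  by (induction \<rho>s) (auto dest: perfect_matching_bulletD)

text \<open>By bilinearity, products of generators suffice: first the right factor is expanded
  against a fixed generator, then the left one.\<close>

lemma span_mult_closed:
  fixes B :: "('a::monoid_add \<Rightarrow>\<^sub>0 'k::field) set"
  assumes B: "\<And>x y. x \<in> B \<Longrightarrow> y \<in> B \<Longrightarrow> x * y \<in> pm.span B"
    and x: "x \<in> pm.span B" and y: "y \<in> pm.span B"
  shows "x * y \<in> pm.span B"
proof -
  have 1: "b * y \<in> pm.span B" if "b \<in> B" for b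
    using y
    by (induction rule: pm.span_induct_alt)
      (auto simp: distrib_left pscale_mult_right pm.span_zero intro!: pm.span_add pm.span_scale B that)
  show ?thesis
    using x
    by (induction rule: pm.span_induct_alt)
      (auto simp: distrib_right pscale_mult_left pm.span_zero intro!: pm.span_add pm.span_scale 1)
qed

lemma tens_in_tensor_square: "x \<in> V \<Longrightarrow> y \<in> V \<Longrightarrow> tens x y \<in> tensor_square V"
  unfolding tensor_square_def by (blast intro: pm.span_base)

text \<open>Pure tensors multiply componentwise by \<open>tens_mult\<close>, so the generators of
  the tensor square are closed under products.\<close>

lemma tensor_square_mult_closed:
  assumes V: "\<And>x y. x \<in> V \<Longrightarrow> y \<in> V \<Longrightarrow> x * y \<in> V"
    and ab: "a \<in> tensor_square V" "b \<in> tensor_square V"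
  shows "a * b \<in> tensor_square V"
proof -
  have "s * t \<in> tensor_square V"
    if "s \<in> {tens x y | x y. x \<in> V \<and> y \<in> V}" "t \<in> {tens x y | x y. x \<in> V \<and> y \<in> V}" for s t
    using that by (auto simp: tens_mult intro!: tens_in_tensor_square V)
  then show ?thesis
    using ab unfolding tensor_square_def by (rule span_mult_closed)
qed

lemma linear_span_into:
  assumes "Vector_Spaces.linear pscale pscale f" "pm.subspace W" "f ` B \<subseteq> W"
  shows "f ` pm.span B \<subseteq> W"
proof -
  interpret f: Vector_Spaces.linear pscale pscale f by fact
  have "f ` pm.span B = pm.span (f ` B)" using f.span_image by blast
  then show ?thesis using pm.span_minimal[OF assms(3,2)] by simp
qed

abbreviation matching_span :: "'k::field parsym set" where
  "matching_span \<equiv> pm.span (H ` {\<pi>. perfect_matching \<pi>})"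

lemma H_in_matching_span: "perfect_matching \<pi> \<Longrightarrow> H \<pi> \<in> matching_span"
  by (auto intro: pm.span_base)

lemma matching_span_mult:
  "x \<in> matching_span \<Longrightarrow> y \<in> matching_span \<Longrightarrow> x * y \<in> matching_span"
  by (rule span_mult_closed) (auto simp: H_mult intro!: H_in_matching_span simp: perfect_matching_add)

text \<open>Induction along the factorization into irreducibles: splittings of an irreducible
  matching involve only matchings, and multiplicativity of \<open>comult\<close> handles
  \<open>\<pi> + \<rho>\<close>.\<close>

lemma comult_H_matching:
  "perfect_matching \<pi> \<Longrightarrow> comult (H \<pi>) \<in> tensor_square (matching_span :: 'k::field parsym set)"
proof (induction \<pi> rule: pdiag_induct)
  case zero
  then show ?case
    using is_comult_comult[where 'a='k]
    by (simp add: is_comult_def tens_in_tensor_square H_in_matching_span)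
next
  case (irreducible \<pi>)
  have "tens (H G\<^sub>1) (H G\<^sub>2) \<in> tensor_square (matching_span :: 'k parsym set)"
    if "(G\<^sub>1, G\<^sub>2) \<in> irreducible_splittings \<pi>" for G\<^sub>1 G\<^sub>2
    using that irreducible.prems
    by (auto simp: irreducible_splittings_def
        intro!: tens_in_tensor_square H_in_matching_span dest: perfect_matching_bulletD)
  then have "(\<Sum>(G\<^sub>1, G\<^sub>2) \<in> irreducible_splittings \<pi>. tens (H G\<^sub>1) (H G\<^sub>2))
      \<in> tensor_square (matching_span :: 'k parsym set)"
    unfolding tensor_square_def by (intro pm.span_sum) auto
  then show ?case
    using is_comult_comult[where 'a='k] irreducible.hyps by (simp add: is_comult_def)
next
  case (tensor \<pi> \<rho>)
  then show ?case
    using is_comult_comult[where 'a='k]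
    by (simp add: is_comult_def perfect_matching_add tensor_square_mult_closed matching_span_mult
        flip: H_mult)
qed

text \<open>Same induction as for \<open>comult\<close>; the reversal of factors by the antimorphism
  is harmless because the span is closed under products in either order.\<close>

lemma antipode_H_matching:
  "perfect_matching \<pi> \<Longrightarrow> antipode (H \<pi>) \<in> (matching_span :: 'k::field parsym set)"
proof (induction \<pi> rule: pdiag_induct)
  case zero
  then show ?case
    using is_antipode_antipode[where 'a='k] by (simp add: is_antipode_def H_in_matching_span)
next
  case (irreducible \<pi>)
  \<comment> \<open>The empty product is \<open>1 = H 0\<close>, which lies in the span because the
    empty diagram is a matching.\<close>
  have prod: "prod_list (map H \<rho>s) \<in> (matching_span :: 'k parsym set)"
    if "\<forall>\<rho>\<in>set \<rho>s. perfect_matching \<rho>" for \<rho>s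
    using that
  proof (induction \<rho>s)
    case Nil
    then show ?case using H_in_matching_span[OF perfect_matching_0] by (simp add: H_0)
  next
    case (Cons \<rho> \<rho>s)
    then show ?case by (simp add: matching_span_mult H_in_matching_span)
  qed
  have "(\<Sum>\<rho>s \<in> bullet_factorizations \<pi>. pscale ((- 1) ^ length \<rho>s) (prod_list (map H \<rho>s)))
      \<in> (matching_span :: 'k parsym set)"
    using irreducible.prems perfect_matching_foldr_bulletD
    by (intro pm.span_sum pm.span_scale prod) (auto simp: bullet_factorizations_def)
  then show ?case
    using is_antipode_antipode[where 'a='k] irreducible.hyps by (simp add: is_antipode_def)
next
  case (tensor \<pi> \<rho>)
  then show ?case
    using is_antipode_antipode[where 'a='k]
    by (simp add: is_antipode_def perfect_matching_add matching_span_mult flip: H_mult)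
qed

theorem theorem4p3:
  shows "hopf_subalgebra
    (pm.span (H ` {\<pi>. perfect_matching \<pi>}) :: 'k::field parsym set)"
  unfolding hopf_subalgebra_def
proof (intro conjI ballI)
  \<comment> \<open>Linearity reduces this inclusion and the next to the basis elements
    \<open>H \<pi>\<close> with \<open>\<pi>\<close> a matching.\<close>
  show "comult ` matching_span \<subseteq> tensor_square (matching_span :: 'k parsym set)"
    using is_comult_comult[where 'a='k] comult_H_matching
    by (intro linear_span_into) (auto simp: is_comult_def tensor_square_def)
  show "antipode ` matching_span \<subseteq> (matching_span :: 'k parsym set)"
    using is_antipode_antipode[where 'a='k] antipode_H_matching
    by (intro linear_span_into) (auto simp: is_antipode_def)
qed (auto intro: matching_span_mult H_in_matching_span perfect_matching_0)

end
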